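(* Let $c>0$ be a numerical constant such that for every $n\ge 2$ there is a norm $\|\cdot\|_{X_n}$ on $\mathbb{R}^n$ with the following properties (such a constant is known to exist), where $X_n=(\mathbb{R}^n,\|\cdot\|_{X_n})$: (i) $X_n$ is isometrically isomorphic to a quotient of $\ell_1^{2n}$; (ii) $\|x\|_2\le \|x\|_{X_n}\le \|x\|_1$ for every $x\in\mathbb{R}^n$; (iii) for every $T\in L(\mathbb{R}^n)$ there are $\lambda_T\in\mathbb{R}$, $V_T\in L(\mathbb{R}^n)$ and a linear subspace $E_T\subset\mathbb{R}^n$ with $\dim E_T>\frac{7n}{8}$ such that (a) $V_T=T+\lambda_T\,\mathrm{Id}_{\mathbb{R}^n}$, (b) $|\lambda_T|\le c\,\|T\|_{X_n}$, (c) $\|V_T|_{E_T}\|_2\le c\,n^{-1/2}\|T\|_{X_n}$. Then there is a numerical constant $K>0$ (independent of $n$) such that, whenever $n\ge 2$ and $X_n$ is a space with properties (i)–(iii) (with this $c$), for every operator $T\in L(\mathbb{R}^n)$ we have $$\inf\{\,c_{n/2}(T-\lambda\,\mathrm{Id}_{\mathbb{R}^n}) : \lambda\in\mathbb{R}\,\}\le K\,n^{-1/2}\,\|T\|_{X_n},$$ where $c_{n/2}$ denotes the Gelfand number of the operator regarded as acting from $X_n$ to $X_n$.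
   Context: $L(\mathbb{R}^n)$ is the space of linear operators on $\mathbb{R}^n$. $\|\cdot\|_1$ and $\|\cdot\|_2$ are the $\ell_1$ and Euclidean norms on $\mathbb{R}^n$, and $\ell_1^{N}=(\mathbb{R}^N,\|\cdot\|_1)$. For $T\in L(\mathbb{R}^n)$, $\|T\|_{X_n}$ is the operator norm of $T:X_n\to X_n$. For a subspace $F\subset\mathbb{R}^n$, $\|V|_F\|_2$ is the operator norm of $V|_F:(F,\|\cdot\|_2)\to(\mathbb{R}^n,\|\cdot\|_2)$. For a linear operator $u:X\to Y$ between normed spaces, the $k$-th Gelfand number is $$c_k(u)=\inf\{\|u|_Z\| : Z\subset X \text{ a linear subspace},\ \operatorname{codim} Z<k\}.$$ The expression $n/2$ is treated as if it were an integer; for odd $n$ one reads $c_{n/2}$ through the same formula, with the condition $\operatorname{codim} Z<n/2$. *)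

theory Defs
  imports "HOL-Analysis.Analysis" "HOL-Analysis.Finite_Function_Topology"
begin

text \<open>
  The constants in the theorem are uniform in the dimension \<open>n\<close>, so \<open>n\<close> has to be an ordinary
  variable rather than a type.  We therefore realise all the spaces \<open>\<real>\<^sup>n\<close> inside the single real
  vector space of finitely supported sequences, as the vectors supported on \<open>{0..<n}\<close>, and use the
  library notions of subspace and dimension there.  The library norm on this type is not used.
\<close>

type_synonym seq = "nat \<Rightarrow>\<^sub>0 real"

definition Rn :: "nat \<Rightarrow> seq set" where
  "Rn n = {x. \<forall>i\<ge>n. Poly_Mapping.lookup x i = 0}"

definition l1 :: "nat \<Rightarrow> seq \<Rightarrow> real" where
  "l1 n x = (\<Sum>i<n. \<bar>Poly_Mapping.lookup x i\<bar>)"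

definition l2 :: "nat \<Rightarrow> seq \<Rightarrow> real" where
  "l2 n x = sqrt (\<Sum>i<n. (Poly_Mapping.lookup x i)\<^sup>2)"

definition norm_on :: "'a::real_vector set \<Rightarrow> ('a \<Rightarrow> real) \<Rightarrow> bool" where
  "norm_on V N \<longleftrightarrow>
     (\<forall>x\<in>V. 0 \<le> N x) \<and>
     (\<forall>x\<in>V. N x = 0 \<longleftrightarrow> x = 0) \<and>
     (\<forall>a. \<forall>x\<in>V. N (a *\<^sub>R x) = \<bar>a\<bar> * N x) \<and>
     (\<forall>x\<in>V. \<forall>y\<in>V. N (x + y) \<le> N x + N y)"

text \<open>Linear operators on \<open>V\<close>; their values outside \<open>V\<close> are irrelevant.\<close>

definition lin_ops :: "'a::real_vector set \<Rightarrow> ('a \<Rightarrow> 'a) set" where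
  "lin_ops V = {T \<in> V \<rightarrow> V.
     (\<forall>x\<in>V. \<forall>y\<in>V. T (x + y) = T x + T y) \<and>
     (\<forall>a. \<forall>x\<in>V. T (a *\<^sub>R x) = a *\<^sub>R T x)}"

text \<open>
  Norm of the restriction to the subspace \<open>F\<close> of a linear map into a space with norm \<open>M\<close>, where
  \<open>F\<close> carries the norm \<open>N\<close>.  The set below contains \<open>M 0 = 0\<close>, and for finite-dimensional
  \<open>F\<close> it is bounded above, so the supremum is the true one.
\<close>

definition op_norm_on ::
  "'a::real_vector set \<Rightarrow> ('a \<Rightarrow> real) \<Rightarrow> ('b::real_vector \<Rightarrow> real) \<Rightarrow> ('a \<Rightarrow> 'b) \<Rightarrow> real" where
  "op_norm_on F N M u = (SUP x\<in>{x\<in>F. N x \<le> 1}. M (u x))"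

text \<open>
  The Gelfand number \<open>c\<^sub>k(u)\<close> of \<open>u : (V,N) \<rightarrow> (Y,M)\<close> for finite-dimensional \<open>V\<close>, where the
  codimension of a subspace is the difference of the dimensions.  The index \<open>k\<close> is real, so that
  \<open>n/2\<close> is admitted for odd \<open>n\<close>.
\<close>

definition gelfand_number ::
  "real \<Rightarrow> 'a::real_vector set \<Rightarrow> ('a \<Rightarrow> real) \<Rightarrow> ('b::real_vector \<Rightarrow> real) \<Rightarrow> ('a \<Rightarrow> 'b) \<Rightarrow> real"
  where
  "gelfand_number k V N M u =
     (INF Z\<in>{Z. subspace Z \<and> Z \<subseteq> V \<and> real (dim V) - real (dim Z) < k}. op_norm_on Z N M u)"

text \<open>
  The quotient space \<open>V/W\<close> is the set of cosets \<open>V // coset_rel V W\<close>, with the vector operations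
  given through representatives, and with the quotient norm \<open>C \<mapsto> inf {N x | x \<in> C}\<close>.
\<close>

definition coset_rel :: "'a::real_vector set \<Rightarrow> 'a set \<Rightarrow> ('a \<times> 'a) set" where
  "coset_rel V W = {(x, y). x \<in> V \<and> y \<in> V \<and> x - y \<in> W}"

abbreviation coset :: "'a::real_vector set \<Rightarrow> 'a set \<Rightarrow> 'a \<Rightarrow> 'a set" where
  "coset V W x \<equiv> coset_rel V W `` {x}"

definition quot_norm :: "('a::real_vector \<Rightarrow> real) \<Rightarrow> 'a set \<Rightarrow> real" where
  "quot_norm N C = (INF x\<in>C. N x)"

definition isometric_to_quotient ::
  "'b::real_vector set \<Rightarrow> ('b \<Rightarrow> real) \<Rightarrow> 'a::real_vector set \<Rightarrow> ('a \<Rightarrow> real) \<Rightarrow> bool" where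
  "isometric_to_quotient X M V N \<longleftrightarrow>
     (\<exists>W \<Phi>. subspace W \<and> W \<subseteq> V \<and>
        bij_betw \<Phi> (V // coset_rel V W) X \<and>
        (\<forall>x\<in>V. \<forall>y\<in>V. \<Phi> (coset V W (x + y)) = \<Phi> (coset V W x) + \<Phi> (coset V W y)) \<and>
        (\<forall>a. \<forall>x\<in>V. \<Phi> (coset V W (a *\<^sub>R x)) = a *\<^sub>R \<Phi> (coset V W x)) \<and>
        (\<forall>C \<in> V // coset_rel V W. M (\<Phi> C) = quot_norm N C))"

text \<open>
  \<open>(\<real>\<^sup>n, N)\<close> is isometric to a quotient of \<open>\<ell>\<^sub>1\<close> in dimension \<open>2n\<close>, its norm lies between the
  Euclidean norm and the \<open>\<ell>\<^sub>1\<close> norm, and every operator on it is a multiple of the identity up to an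
  operator that is small, in the Euclidean norm, on a subspace of dimension greater than \<open>7n/8\<close>.
\<close>

definition few_ops_space :: "real \<Rightarrow> nat \<Rightarrow> (seq \<Rightarrow> real) \<Rightarrow> bool" where
  "few_ops_space c n N \<longleftrightarrow>
     norm_on (Rn n) N \<and>
     isometric_to_quotient (Rn n) N (Rn (2 * n)) (l1 (2 * n)) \<and>
     (\<forall>x \<in> Rn n. l2 n x \<le> N x \<and> N x \<le> l1 n x) \<and>
     (\<forall>T \<in> lin_ops (Rn n). \<exists>l. \<exists>V \<in> lin_ops (Rn n). \<exists>E.
        subspace E \<and> E \<subseteq> Rn n \<and> real (dim E) > 7 * real n / 8 \<and>
        (\<forall>x \<in> Rn n. V x = T x + l *\<^sub>R x) \<and>
        \<bar>l\<bar> \<le> c * op_norm_on (Rn n) N N T \<and>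
        op_norm_on E (l2 n) (l2 n) V \<le> c * real n powr (-1/2) * op_norm_on (Rn n) N N T)"

lemma lookup_scaleR:
  "Poly_Mapping.lookup (a *\<^sub>R x) i = a *\<^sub>R Poly_Mapping.lookup x i"
proof -
  have "finite {i. a *\<^sub>R Poly_Mapping.lookup x i \<noteq> 0}"
    by (rule finite_subset[OF _ finite_keys[of x]]) (auto simp: in_keys_iff)
  then show ?thesis
    by (simp add: scaleR_poly_mapping_def Abs_poly_mapping_inverse)
qed

lemma subspace_Rn: "subspace (Rn n)"
  by (auto simp: Rn_def subspace_def lookup_add lookup_scaleR)

lemma dim_Rn: "dim (Rn n) = n"
proof -
  define e :: "nat \<Rightarrow> seq" where "e i = Poly_Mapping.single i 1" for i
  have lk: "Poly_Mapping.lookup (\<Sum>i\<in>A. u i *\<^sub>R e i) j = (if j \<in> A then u j else 0)"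
    if "finite A" for A u j
    using that by induction (auto simp: lookup_add lookup_scaleR e_def lookup_single when_def)
  have inj: "inj e"
    by (rule injI) (metis e_def lookup_single_eq lookup_single_not_eq zero_neq_one)
  have indep: "independent (e ` {..<n})"
  proof (rule independent_if_scalars_zero)
    fix f x assume s: "(\<Sum>y\<in>e ` {..<n}. f y *\<^sub>R y) = 0" and "x \<in> e ` {..<n}"
    then obtain i where i: "i < n" "x = e i" by auto
    have "(\<Sum>j<n. f (e j) *\<^sub>R e j) = 0"
      using s by (subst (asm) sum.reindex[OF inj_on_subset[OF inj subset_UNIV]]) simp
    then show "f x = 0"
      using lk[of "{..<n}" "\<lambda>j. f (e j)" i] i by simp
  qed simp
  have sub: "Rn n \<subseteq> span (e ` {..<n})"
  proof
    fix x assume x: "x \<in> Rn n"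
    have "x = (\<Sum>i<n. Poly_Mapping.lookup x i *\<^sub>R e i)"
      by (rule poly_mapping_eqI) (use x in \<open>auto simp: lk Rn_def not_less\<close>)
    also have "\<dots> \<in> span (e ` {..<n})"
      by (intro span_sum span_scale span_base) auto
    finally show "x \<in> span (e ` {..<n})" .
  qed
  have "e ` {..<n} \<subseteq> Rn n"
    by (auto simp: Rn_def e_def lookup_single when_def)
  from basis_card_eq_dim[OF this sub indep] show ?thesis
    by (simp add: card_image[OF inj_on_subset[OF inj subset_UNIV]])
qed

end

theory Submission
  imports Defs "HOL-Probability.Probability"
begin

text \<open>
  On \<open>E\<close> the operator \<open>V = T + l Id\<close> satisfies
  \<open>N (V x) \<le> l1 (V x) \<le> \<surd>n l2 (V x) \<le> c \<parallel>T\<parallel> l2 x\<close>, so it suffices to find a subspace of codimension at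
  most \<open>3n/8\<close> on which \<open>\<surd>n l2 x \<le> K N x\<close>, and to intersect it with \<open>E\<close>.  As the unit ball of
  \<open>N\<close> is the absolutely convex hull of \<open>2n\<close> vectors of Euclidean length at most \<open>1\<close>, this is a
  theorem of Kashin type: Maurey's empirical method gives a net of at most \<open>18\<^sup>n\<close> points at scale
  \<open>1/\<surd>n\<close>, and the kernel of a Gaussian matrix with a number of rows proportional to \<open>n\<close> avoids
  all vectors close to the net points of length at least \<open>K/\<surd>n\<close>.
\<close>

section \<open>Gaussian averages\<close>

lemma integral_exp_quadratic_normal:
  assumes s: "\<sigma> > 0" and l: "1 + 2 * l * \<sigma>\<^sup>2 > 0"
  shows "has_bochner_integral lborel (\<lambda>y. normal_density 0 \<sigma> y * exp (- l * y\<^sup>2))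
    (1 / sqrt (1 + 2 * l * \<sigma>\<^sup>2))"
proof -
  define q where "q = sqrt (1 + 2 * l * \<sigma>\<^sup>2)"
  have q: "q > 0" "q\<^sup>2 = 1 + 2 * l * \<sigma>\<^sup>2" using l by (auto simp: q_def)
  have *: "normal_density 0 \<sigma> y * exp (- l * y\<^sup>2) = (1 / q) * normal_density 0 (\<sigma> / q) y" for y
  proof -
    have "- (y\<^sup>2) / (2 * \<sigma>\<^sup>2) - l * y\<^sup>2 = - (y\<^sup>2) / (2 * (\<sigma> / q)\<^sup>2)"
      using s q by (simp add: power_divide field_simps)
    then show ?thesis
      using s q(1) unfolding normal_density_def
      by (simp add: exp_add[symmetric] real_sqrt_mult real_sqrt_divide power_divide)
  qed
  have "has_bochner_integral lborel (normal_density 0 (\<sigma> / q)) 1"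
    using s q by (simp add: has_bochner_integral_iff)
  then have "has_bochner_integral lborel (\<lambda>y. (1 / q) * normal_density 0 (\<sigma> / q) y) ((1 / q) * 1)"
    by (rule has_bochner_integral_mult_right)
  then show ?thesis unfolding * by (simp add: q_def)
qed

text \<open>The linear form is a centred normal variable of variance
  \<open>\<Sum>i<n. (u i)\<^sup>2\<close>, which reduces the average to a one-dimensional
  integral.\<close>

lemma gaussian_form:
  fixes u :: "nat \<Rightarrow> real" and n :: nat
  defines "M \<equiv> PiM {..<n} (\<lambda>_. density lborel std_normal_density)"
  assumes l: "1 + 2 * l * (\<Sum>i<n. (u i)\<^sup>2) > 0"
  shows "has_bochner_integral M (\<lambda>g. exp (- l * (\<Sum>i<n. u i * g i)\<^sup>2))
    (1 / sqrt (1 + 2 * l * (\<Sum>i<n. (u i)\<^sup>2)))"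
proof -
  let ?G = "density lborel std_normal_density"
  have ps: "prob_space ?G" using prob_space_normal_density[of 1 0] by simp
  interpret P: prob_space M unfolding M_def by (rule prob_space_PiM) (rule ps)
  \<comment> \<open>Zero coefficients are discarded because the densities of the scaled coordinates
    need a positive deviation; if none remain, the exponent is constantly 0.\<close>
  define I where "I = {i. i < n \<and> u i \<noteq> 0}"
  have I: "finite I" "I \<subseteq> {..<n}" by (auto simp: I_def)
  have sq: "(\<Sum>i<n. (u i)\<^sup>2) = (\<Sum>i\<in>I. (u i)\<^sup>2)"
    by (rule sum.mono_neutral_right) (auto simp: I_def)
  have sl: "(\<Sum>i<n. u i * g i) = (\<Sum>i\<in>I. u i * g i)" for g
    by (rule sum.mono_neutral_right) (auto simp: I_def)
  show ?thesis
  proof (cases "I = {}")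
    case True
    have "has_bochner_integral M (\<lambda>g. 1::real) 1"
      by (simp add: has_bochner_integral_iff P.prob_space)
    then show ?thesis by (simp add: sq sl True)
  next
    case False
    have rv: "(\<lambda>g. g i) \<in> borel_measurable M" if "i < n" for i
    proof -
      have "(\<lambda>g. g i) \<in> measurable M ?G"
        using that unfolding M_def by (intro measurable_component_singleton) auto
      then show ?thesis by simp
    qed
    have dc: "distr M borel (\<lambda>g. g i) = ?G" if "i < n" for i
    proof -
      have "distr M borel (\<lambda>g. g i) = distr M ?G (\<lambda>g. g i)" by (rule distr_cong) auto
      then show ?thesis using that unfolding M_def by (simp add: distr_PiM_component[OF ps])
    qed
    have ind0: "P.indep_vars (\<lambda>_. borel) (\<lambda>i g. g i) {..<n}"
    proof (cases "n = 0")
      case True then show ?thesis using False I by auto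
    next
      case n: False
      show ?thesis
      proof (subst P.indep_vars_iff_distr_eq_PiM'; (use n rv in auto)?)
        \<comment> \<open>Independence means that the joint law is the product of the marginals;
          here the joint law is \<open>M\<close> itself and each marginal is
          \<open>?G\<close>.\<close>
        have "distr M (Pi\<^sub>M {..<n} (\<lambda>_. borel)) (\<lambda>x. \<lambda>i\<in>{..<n}. x i) = distr M M (\<lambda>x. x)"
          by (rule distr_cong) (auto simp: M_def space_PiM PiE_def extensional_restrict intro!: sets_PiM_cong)
        also have "\<dots> = M" by simp
        also have "\<dots> = Pi\<^sub>M {..<n} (\<lambda>i. distr M borel (\<lambda>g. g i))"
          unfolding M_def by (rule PiM_cong) (use dc in \<open>auto simp: M_def\<close>)
        finally show "distr M (Pi\<^sub>M {..<n} (\<lambda>_. borel)) (\<lambda>x. \<lambda>i\<in>{..<n}. x i) = Pi\<^sub>M {..<n} (\<lambda>i. distr M borel (\<lambda>g. g i))" .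
      qed
    qed
    have ind: "P.indep_vars (\<lambda>_. borel) (\<lambda>i g. u i * g i) I"
      using P.indep_vars_compose2[OF P.indep_vars_subset[OF ind0 I(2)], of "\<lambda>i x. u i * x" "\<lambda>_. borel"] by simp
    have d1: "distributed M lborel (\<lambda>g. g i) std_normal_density" if "i < n" for i
      using dc[OF that] rv[OF that] unfolding distributed_def by (auto cong: distr_cong)
    have d2: "distributed M lborel (\<lambda>g. u i * g i) (normal_density 0 \<bar>u i\<bar>)" if "i \<in> I" for i
      using P.normal_density_affine[OF d1, of i "u i" 0] that by (auto simp: I_def)
    have d3: "distributed M lborel (\<lambda>g. \<Sum>i\<in>I. u i * g i) (normal_density (\<Sum>i\<in>I. 0) (sqrt (\<Sum>i\<in>I. \<bar>u i\<bar>\<^sup>2)))"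
      by (rule P.sum_indep_normal[OF I(1) False ind _ d2]) (auto simp: I_def)
    define s where "s = sqrt (\<Sum>i\<in>I. (u i)\<^sup>2)"
    have s2: "s\<^sup>2 = (\<Sum>i\<in>I. (u i)\<^sup>2)" by (simp add: s_def sum_nonneg)
    have s0: "s > 0" unfolding s_def using False by (auto simp: I_def intro!: sum_pos)
    have d: "distributed M lborel (\<lambda>g. \<Sum>i\<in>I. u i * g i) (normal_density 0 s)"
      using d3 by (simp add: s_def)
    have hb: "has_bochner_integral lborel (\<lambda>y. normal_density 0 s y * exp (- l * y\<^sup>2)) (1 / sqrt (1 + 2 * l * s\<^sup>2))"
      by (rule integral_exp_quadratic_normal[OF s0]) (use l in \<open>simp add: s2 sq\<close>)
    show ?thesis
      using hb distributed_integrable[OF d, of "\<lambda>y. exp (- l * y\<^sup>2)"] distributed_integral[OF d, of "\<lambda>y. exp (- l * y\<^sup>2)"]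
      by (simp add: has_bochner_integral_iff s2 sq sl)
  qed
qed

text \<open>First-moment argument: the right-hand side is the Gaussian mean of the left-hand side,
  and some point does not exceed the mean.\<close>

lemma gaussian_step:
  fixes u :: "'i \<Rightarrow> nat \<Rightarrow> real" and n :: nat and l al :: "'i \<Rightarrow> real"
  assumes l: "\<And>a. a \<in> A \<Longrightarrow> 1 + 2 * l a * (\<Sum>i<n. (u a i)\<^sup>2) > 0"
  obtains g :: "nat \<Rightarrow> real" where
    "(\<Sum>a\<in>A. al a * exp (- l a * (\<Sum>i<n. u a i * g i)\<^sup>2))
      \<le> (\<Sum>a\<in>A. al a * (1 / sqrt (1 + 2 * l a * (\<Sum>i<n. (u a i)\<^sup>2))))"
proof -
  define M where "M = PiM {..<n} (\<lambda>_::nat. density lborel std_normal_density)"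
  let ?f = "\<lambda>g::nat\<Rightarrow>real. \<Sum>a\<in>A. al a * exp (- l a * (\<Sum>i<n. u a i * g i)\<^sup>2)"
  let ?c = "\<Sum>a\<in>A. al a * (1 / sqrt (1 + 2 * l a * (\<Sum>i<n. (u a i)\<^sup>2)))"
  interpret P: prob_space M unfolding M_def
    by (rule prob_space_PiM) (use prob_space_normal_density[of 1 0] in simp)
  have hb: "has_bochner_integral M ?f ?c"
    unfolding M_def by (intro has_bochner_integral_sum has_bochner_integral_mult_right gaussian_form l)
  have "\<exists>g. ?f g \<le> ?c"
  proof (rule ccontr)
    assume "\<not> ?thesis"
    then have "\<forall>g. ?c < ?f g" by (simp add: not_le)
    then have "?c < P.expectation ?f"
      using P.expectation_greater[of ?f ?c] hb by (auto simp: has_bochner_integral_iff)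
    then show False using hb by (simp add: has_bochner_integral_iff)
  qed
  then show thesis using that by blast
qed

text \<open>Rows are fixed one at a time, each by averaging over that row alone, which replaces its
  exponential factor by the inverse square root. Arbitrary weights \<open>al\<close> let the
  induction absorb such factors.\<close>

lemma gaussian_rows:
  fixes u :: "'i \<Rightarrow> nat \<Rightarrow> real" and n k :: nat and l al :: "'i \<Rightarrow> real"
  assumes l: "\<And>a. a \<in> A \<Longrightarrow> 1 + 2 * l a * (\<Sum>i<n. (u a i)\<^sup>2) > 0"
  shows "\<exists>g :: nat \<Rightarrow> nat \<Rightarrow> real.
    (\<Sum>a\<in>A. al a * exp (- l a * (\<Sum>j<k. (\<Sum>i<n. u a i * g j i)\<^sup>2)))
      \<le> (\<Sum>a\<in>A. al a * (1 / sqrt (1 + 2 * l a * (\<Sum>i<n. (u a i)\<^sup>2))) ^ k)"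
proof (induction k arbitrary: al)
  case 0
  show ?case by simp
next
  case (Suc k)
  let ?r = "\<lambda>a. 1 / sqrt (1 + 2 * l a * (\<Sum>i<n. (u a i)\<^sup>2))"
  \<comment> \<open>The factor of the row still to come enters the weights before the first
    \<open>k\<close> rows are chosen.\<close>
  obtain g where g: "(\<Sum>a\<in>A. al a * ?r a * exp (- l a * (\<Sum>j<k. (\<Sum>i<n. u a i * g j i)\<^sup>2)))
      \<le> (\<Sum>a\<in>A. al a * ?r a * ?r a ^ k)"
    using Suc.IH[of "\<lambda>a. al a * ?r a"] by blast
  obtain h where h: "(\<Sum>a\<in>A. al a * exp (- l a * (\<Sum>j<k. (\<Sum>i<n. u a i * g j i)\<^sup>2)) * exp (- l a * (\<Sum>i<n. u a i * h i)\<^sup>2))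
      \<le> (\<Sum>a\<in>A. al a * exp (- l a * (\<Sum>j<k. (\<Sum>i<n. u a i * g j i)\<^sup>2)) * ?r a)"
    by (rule gaussian_step[where A = A and u = u and l = l and n = n and al = "\<lambda>a. al a * exp (- l a * (\<Sum>j<k. (\<Sum>i<n. u a i * g j i)\<^sup>2))"]) (use l in auto)
  have e: "exp (- l a * (\<Sum>j<Suc k. (\<Sum>i<n. u a i * (g(k := h)) j i)\<^sup>2))
     = exp (- l a * (\<Sum>j<k. (\<Sum>i<n. u a i * g j i)\<^sup>2)) * exp (- l a * (\<Sum>i<n. u a i * h i)\<^sup>2)" for a
    by (simp add: exp_add[symmetric] algebra_simps)
  show ?case
  proof (intro exI)
    show "(\<Sum>a\<in>A. al a * exp (- l a * (\<Sum>j<Suc k. (\<Sum>i<n. u a i * (g(k := h)) j i)\<^sup>2)))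
      \<le> (\<Sum>a\<in>A. al a * ?r a ^ Suc k)"
      unfolding e using order_trans[OF h[unfolded mult.assoc] order_trans[OF eq_refl g]]
      by (simp add: mult_ac)
  qed
qed

section \<open>Maurey's empirical method\<close>

text \<open>Averaging the distance over a random sign-adjusted generator, chosen with probabilities
  \<open>\<bar>a i\<bar>\<close> and zero otherwise, cancels the cross terms.\<close>

lemma maurey_step:
  fixes a :: "'i \<Rightarrow> real" and q :: "'r \<Rightarrow> 'i \<Rightarrow> real" and y :: "'r \<Rightarrow> real"
  assumes J: "finite J" and a: "(\<Sum>i\<in>J. \<bar>a i\<bar>) \<le> 1" and B: "B \<ge> 0"
    and q: "\<forall>i\<in>J. (\<Sum>r\<in>R. (q r i)\<^sup>2) \<le> B"
  defines "x \<equiv> \<lambda>r. \<Sum>i\<in>J. a i * q r i"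
  shows "(\<Sum>r\<in>R. (y r + x r)\<^sup>2) \<le> (\<Sum>r\<in>R. (y r)\<^sup>2) + B \<or>
    (\<exists>i\<in>J. (\<Sum>r\<in>R. (y r + x r - sgn (a i) * q r i)\<^sup>2) \<le> (\<Sum>r\<in>R. (y r)\<^sup>2) + B)"
proof (rule ccontr)
  define K where "K = (\<Sum>r\<in>R. (y r)\<^sup>2) + B"
  define Q where "Q i = (\<Sum>r\<in>R. (y r + x r - sgn (a i) * q r i)\<^sup>2)" for i
  define Q0 where "Q0 = (\<Sum>r\<in>R. (y r + x r)\<^sup>2)"
  define A where "A = (\<Sum>i\<in>J. \<bar>a i\<bar>)"
  assume "\<not> ?thesis"
  then have gt: "Q0 > K" "\<And>i. i \<in> J \<Longrightarrow> Q i > K"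
    by (auto simp: K_def Q_def Q0_def not_le)
  \<comment> \<open>The weights \<open>\<bar>a i\<bar>\<close>, together with \<open>1 - A\<close>
    for the zero vector, add up to 1 and produce the mean \<open>x r\<close>; completing the square
    gives the identity. At \<open>p = y r + x r\<close> its first square is
    \<open>(y r)\<^sup>2\<close>.\<close>
  have point: "(\<Sum>i\<in>J. \<bar>a i\<bar> * (p - sgn (a i) * q r i)\<^sup>2) + (1 - A) * p\<^sup>2
      = (p - x r)\<^sup>2 - (x r)\<^sup>2 + (\<Sum>i\<in>J. \<bar>a i\<bar> * (q r i)\<^sup>2)" for p r
  proof -
    have "\<bar>a i\<bar> * (p - sgn (a i) * q r i)\<^sup>2 = p\<^sup>2 * \<bar>a i\<bar> - 2 * p * (a i * q r i) + \<bar>a i\<bar> * (q r i)\<^sup>2" for i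
      by (cases "a i" "0 :: real" rule: linorder_cases) (auto simp: power2_eq_square algebra_simps)
    then have "(\<Sum>i\<in>J. \<bar>a i\<bar> * (p - sgn (a i) * q r i)\<^sup>2)
        = p\<^sup>2 * A - 2 * p * x r + (\<Sum>i\<in>J. \<bar>a i\<bar> * (q r i)\<^sup>2)"
      by (simp add: sum.distrib sum_subtractf sum_distrib_left A_def x_def)
    then show ?thesis by (simp add: power2_eq_square algebra_simps)
  qed
  have "(\<Sum>i\<in>J. \<bar>a i\<bar> * Q i) + (1 - A) * Q0
    = (\<Sum>r\<in>R. (\<Sum>i\<in>J. \<bar>a i\<bar> * (y r + x r - sgn (a i) * q r i)\<^sup>2) + (1 - A) * (y r + x r)\<^sup>2)"
    unfolding Q_def Q0_def sum_distrib_left sum.distrib by (subst sum.swap) simp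
  also have "\<dots> = (\<Sum>r\<in>R. (y r)\<^sup>2 - (x r)\<^sup>2 + (\<Sum>i\<in>J. \<bar>a i\<bar> * (q r i)\<^sup>2))"
    unfolding point by simp
  also have "\<dots> \<le> (\<Sum>r\<in>R. (y r)\<^sup>2 + (\<Sum>i\<in>J. \<bar>a i\<bar> * (q r i)\<^sup>2))"
    by (intro sum_mono) simp
  also have "\<dots> = (\<Sum>r\<in>R. (y r)\<^sup>2) + (\<Sum>i\<in>J. \<bar>a i\<bar> * (\<Sum>r\<in>R. (q r i)\<^sup>2))"
    by (simp add: sum.distrib sum_distrib_left) (subst sum.swap, simp)
  also have "(\<Sum>i\<in>J. \<bar>a i\<bar> * (\<Sum>r\<in>R. (q r i)\<^sup>2)) \<le> A * B"
    unfolding A_def sum_distrib_right by (intro sum_mono mult_left_mono) (use q in auto)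
  also have "A * B \<le> B" using a B mult_right_mono[of A 1 B] by (simp add: A_def)
  finally have "(\<Sum>i\<in>J. \<bar>a i\<bar> * Q i) + (1 - A) * Q0 \<le> K" by (simp add: K_def)
  then have le: "(\<Sum>i\<in>J. \<bar>a i\<bar> * (Q i - K)) + (1 - A) * (Q0 - K) \<le> 0"
  proof -
    have "(\<Sum>i\<in>J. \<bar>a i\<bar> * (Q i - K)) = (\<Sum>i\<in>J. \<bar>a i\<bar> * Q i) - A * K"
      by (simp add: right_diff_distrib sum_subtractf A_def sum_distrib_right)
    then show ?thesis using \<open>(\<Sum>i\<in>J. \<bar>a i\<bar> * Q i) + (1 - A) * Q0 \<le> K\<close>
      by (simp add: algebra_simps)
  qed
  have nn: "(\<Sum>i\<in>J. \<bar>a i\<bar> * (Q i - K)) \<ge> 0"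
    by (intro sum_nonneg mult_nonneg_nonneg) (use gt in \<open>auto intro: less_imp_le\<close>)
  show False
  \<comment> \<open>A strict inequality requires an option of positive weight: the zero vector if
    \<open>A < 1\<close>, otherwise a generator with \<open>a i \<noteq> 0\<close>.\<close>
  proof (cases "A < 1")
    case True
    then have "(1 - A) * (Q0 - K) > 0" using gt by simp
    then show False using le nn by linarith
  next
    case False
    then have A: "A = 1" using a by (simp add: A_def)
    then obtain i where i: "i \<in> J" "a i \<noteq> 0" unfolding A_def by (metis abs_zero sum.neutral zero_neq_one)
    have "(\<Sum>i\<in>J. \<bar>a i\<bar> * (Q i - K)) > 0"
      by (rule sum_pos2[OF J i(1)]) (use i gt(2) in \<open>auto intro!: mult_nonneg_nonneg simp: less_imp_le\<close>)
    then show False using le A by simp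
  qed
qed

text \<open>Greedy choice: each of \<open>N\<close> rounds adds one signed generator or nothing, and
  by \<open>maurey_step\<close> the squared error grows by at most \<open>B\<close>. Aiming at
  \<open>N\<close> times the target keeps the coefficients integral, so that the approximants can be
  counted.\<close>

lemma maurey_approximation:
  fixes a :: "'i \<Rightarrow> real" and q :: "'r \<Rightarrow> 'i \<Rightarrow> real"
  assumes J: "finite J" and a: "(\<Sum>i\<in>J. \<bar>a i\<bar>) \<le> 1" and B: "B \<ge> 0"
    and q: "\<And>i. i \<in> J \<Longrightarrow> (\<Sum>r\<in>R. (q r i)\<^sup>2) \<le> B"
  shows "\<exists>m :: 'i \<Rightarrow> int. (\<Sum>i\<in>J. \<bar>m i\<bar>) \<le> int N \<and>
    (\<Sum>r\<in>R. (real N * (\<Sum>i\<in>J. a i * q r i) - (\<Sum>i\<in>J. real_of_int (m i) * q r i))\<^sup>2) \<le> real N * B"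
proof (induction N)
  case 0
  show ?case by (intro exI[of _ "\<lambda>_. 0"]) simp
next
  case (Suc N)
  then obtain m :: "'i \<Rightarrow> int" where m: "(\<Sum>i\<in>J. \<bar>m i\<bar>) \<le> int N"
    "(\<Sum>r\<in>R. (real N * (\<Sum>i\<in>J. a i * q r i) - (\<Sum>i\<in>J. real_of_int (m i) * q r i))\<^sup>2) \<le> real N * B"
    by blast
  let ?x = "\<lambda>r. \<Sum>i\<in>J. a i * q r i"
  let ?s = "\<lambda>m r. \<Sum>i\<in>J. real_of_int (m i) * q r i"
  let ?y = "\<lambda>r. real N * ?x r - ?s m r"
  have S: "real (Suc N) * ?x r - t = ?y r + ?x r - (t - ?s m r)" for r t
    by (simp add: algebra_simps)
  have "\<forall>i\<in>J. (\<Sum>r\<in>R. (q r i)\<^sup>2) \<le> B" using q by blast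
  from maurey_step[OF J a B this, of ?y] show ?case
  proof (elim disjE bexE)
    assume "(\<Sum>r\<in>R. (?y r + ?x r)\<^sup>2) \<le> (\<Sum>r\<in>R. (?y r)\<^sup>2) + B"
    then show ?case
      using m unfolding S by (intro exI[of _ m]) (auto simp: algebra_simps)
  next
    fix i assume i: "i \<in> J"
      and le: "(\<Sum>r\<in>R. (?y r + ?x r - sgn (a i) * q r i)\<^sup>2) \<le> (\<Sum>r\<in>R. (?y r)\<^sup>2) + B"
    define e :: int where "e = (if a i > 0 then 1 else if a i = 0 then 0 else - 1)"
    define m' where "m' = m(i := m i + e)"
    have "(\<Sum>j\<in>J. \<bar>m' j\<bar>) \<le> (\<Sum>j\<in>J. \<bar>m j\<bar> + (if j = i then 1 else 0))"
      by (rule sum_mono) (auto simp: m'_def e_def)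
    also have "\<dots> \<le> int (Suc N)"
      using m(1) i J by (simp add: sum.distrib)
    finally have 1: "(\<Sum>j\<in>J. \<bar>m' j\<bar>) \<le> int (Suc N)" .
    have "?s m' r = (\<Sum>j\<in>J. real_of_int (m j) * q r j + (if j = i then sgn (a i) * q r i else 0))" for r
      by (rule sum.cong) (auto simp: m'_def e_def algebra_simps sgn_if)
    then have "?s m' r - ?s m r = sgn (a i) * q r i" for r
      using i J by (simp add: sum.distrib)
    then have "(\<Sum>r\<in>R. (real (Suc N) * ?x r - ?s m' r)\<^sup>2) \<le> real (Suc N) * B"
      unfolding S using le m(2) by (simp add: algebra_simps)
    then show ?case using 1 by blast
  qed
qed

section \<open>Counting integer points of an l1 ball\<close>

lemma sum_half_power_abs: "(\<Sum>j\<in>{- int N..int N}. (1 / 2 :: real) ^ nat \<bar>j\<bar>) = 3 - 2 * (1 / 2) ^ N"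
proof (induction N)
  case 0
  show ?case by simp
next
  case (Suc N)
  have "{- int (Suc N)..int (Suc N)} = insert (- int (Suc N)) (insert (int (Suc N)) {- int N..int N})"
    by auto
  moreover have "nat (1 + int N) = Suc N" "nat \<bar>- 1 - int N\<bar> = Suc N" by auto
  ultimately show ?case using Suc.IH by (simp add: abs_if)
qed

text \<open>Extensional functions into a box form a finite product, over which sums of product
  weights factorise.\<close>

definition int_ball :: "'i set \<Rightarrow> nat \<Rightarrow> ('i \<Rightarrow> int) set" where
  "int_ball J N = {m \<in> J \<rightarrow>\<^sub>E {- int N..int N}. (\<Sum>i\<in>J. \<bar>m i\<bar>) \<le> int N}"

lemma finite_int_ball: "finite J \<Longrightarrow> finite (int_ball J N)"
  unfolding int_ball_def by (rule finite_subset[of _ "J \<rightarrow>\<^sub>E {- int N..int N}"]) (auto intro: finite_PiE)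

text \<open>Each point has weight at least \<open>(1/2)^N\<close> for the product of the weights \<open>(1/2)^\<bar>m i\<bar>\<close>, whose
  total mass is at most \<open>3\<close> per coordinate.\<close>

lemma card_int_ball:
  assumes J: "finite J"
  shows "real (card (int_ball J N)) \<le> 2 ^ N * 3 ^ card J"
proof -
  let ?P = "J \<rightarrow>\<^sub>E {- int N..int N}"
  let ?w = "\<lambda>m. \<Prod>i\<in>J. (1 / 2 :: real) ^ nat \<bar>m i\<bar>"
  have fin: "finite ?P" using J by (intro finite_PiE) auto
  have w: "?w m \<ge> (1 / 2) ^ N" if "m \<in> int_ball J N" for m
  proof -
    have "int (\<Sum>i\<in>J. nat \<bar>m i\<bar>) \<le> int N"
      using that by (simp add: int_ball_def)
    then have "(\<Sum>i\<in>J. nat \<bar>m i\<bar>) \<le> N" by linarith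
    then show ?thesis
      by (subst power_sum[symmetric]) (auto intro!: power_decreasing)
  qed
  have "real (card (int_ball J N)) * (1 / 2) ^ N \<le> (\<Sum>m\<in>int_ball J N. ?w m)"
    using w sum_bounded_below[of "int_ball J N" "(1/2)^N" ?w] by simp
  also have "\<dots> \<le> (\<Sum>m\<in>?P. ?w m)"
    by (rule sum_mono2[OF fin]) (auto simp: int_ball_def intro: prod_nonneg)
  also have "\<dots> = (\<Prod>i\<in>J. \<Sum>j\<in>{- int N..int N}. (1 / 2 :: real) ^ nat \<bar>j\<bar>)"
    by (rule prod_sum_PiE[symmetric]) (use J in auto)
  also have "\<dots> \<le> 3 ^ card J"
    unfolding sum_half_power_abs prod_constant
    by (rule power_mono) (use power_le_one[of "1 / 2 :: real" N] in auto)
  finally show ?thesis by (simp add: field_simps)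
qed

section \<open>A Kashin-type theorem\<close>

text \<open>
  The Gaussian potential has two kinds of terms: those of a net of integer combinations of the
  \<open>v i\<close> force \<open>\<parallel>G y\<parallel>\<^sup>2 > 32 n\<^sup>2\<close> for every net point \<open>y\<close> of large Euclidean norm, and those of the
  generators force \<open>\<parallel>G (v i)\<parallel>\<^sup>2 < 16 n\<close>.  The second bound makes the Maurey approximation work
  simultaneously for the Euclidean norm and for \<open>G\<close>, so no operator norm bound on \<open>G\<close> is needed.
  A net term is at most \<open>3^n / (216^8)^k \<le> (1/72)^n\<close>, which beats the \<open>18^n\<close> net points; hence \<open>216\<close>.
\<close>

lemma kashin_rows:
  fixes v :: "nat \<Rightarrow> nat \<Rightarrow> real" and n k :: nat
  assumes n: "n \<ge> 1" and k: "n \<le> 8 * k" "k \<le> n"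
    and v: "\<And>i. i < 2 * n \<Longrightarrow> (\<Sum>s<n. (v i s)\<^sup>2) \<le> 1"
  shows "\<exists>g :: nat \<Rightarrow> nat \<Rightarrow> real. \<forall>a. (\<Sum>i<2*n. \<bar>a i\<bar>) \<le> 1 \<longrightarrow>
      (\<forall>j<k. (\<Sum>s<n. (\<Sum>i<2*n. a i * v i s) * g j s) = 0) \<longrightarrow>
      real n * (\<Sum>s<n. (\<Sum>i<2*n. a i * v i s)\<^sup>2) \<le> 4 + 32 * 216 ^ 16"
proof -
  define y where "y m s = (\<Sum>i<2*n. real_of_int (m i) * v i s)" for m :: "nat \<Rightarrow> int" and s
  \<comment> \<open>The threshold makes the quantity under the root at least \<open>216 ^ 16\<close>
    for these points; the inverse root is then at most \<open>1 / 216 ^ 8\<close>, and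
    \<open>n \<le> 8 * k\<close> bounds its \<open>k\<close>-th power by
    \<open>(1 / 216) ^ n\<close>.\<close>
  define S where "S = {m \<in> int_ball {..<2*n} n. (\<Sum>s<n. (y m s)\<^sup>2) \<ge> 16 * 216 ^ 16 * real n}"
  define A where "A = S <+> {..<2*n}"
  define u where "u = case_sum y v"
  \<comment> \<open>For a squared image length \<open>t\<close>, a term below 1 is exactly the
    wanted bound: \<open>exp (n - t / (32 * n)) < 1\<close> says \<open>t > 32 * n\<^sup>2\<close>,
    and \<open>exp (t / 4 - 4 * n) < 1\<close> says \<open>t < 16 * n\<close>.\<close>
  define l :: "(nat \<Rightarrow> int) + nat \<Rightarrow> real" where "l = case_sum (\<lambda>_. 1 / (32 * n)) (\<lambda>_. - 1 / 4)"
  define al :: "(nat \<Rightarrow> int) + nat \<Rightarrow> real" where "al = case_sum (\<lambda>_. exp (real n)) (\<lambda>_. exp (- 4 * real n))"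
  have finS: "finite S" unfolding S_def using finite_int_ball[of "{..<2*n}" n] by simp
  have fin: "finite A" unfolding A_def using finS by simp
  have l: "1 + 2 * l a * (\<Sum>s<n. (u a s)\<^sup>2) > 0" if "a \<in> A" for a
  proof (cases a)
    case (Inl m)
    then show ?thesis by (auto simp: l_def intro!: add_pos_nonneg sum_nonneg divide_nonneg_nonneg)
  next
    case (Inr i)
    then show ?thesis using that v[of i] by (auto simp: A_def l_def u_def)
  qed
  obtain g where g: "(\<Sum>a\<in>A. al a * exp (- l a * (\<Sum>j<k. (\<Sum>s<n. u a s * g j s)\<^sup>2)))
      \<le> (\<Sum>a\<in>A. al a * (1 / sqrt (1 + 2 * l a * (\<Sum>s<n. (u a s)\<^sup>2))) ^ k)"
    using gaussian_rows[of A l u n al k] l by auto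
  have e3: "exp (real n) \<le> 3 ^ n"
    using power_mono[OF exp_le, of n] by (simp add: exp_of_nat_mult[symmetric])
  have quarter: "(1 / 4 :: real) ^ n \<le> 1 / 4"
    using n power_decreasing[of 1 n "1 / 4 :: real"] by simp
  have sumS: "(\<Sum>m\<in>S. exp (real n) * (1 / sqrt (1 + 2 * (1 / (32 * n)) * (\<Sum>s<n. (y m s)\<^sup>2))) ^ k) \<le> 1 / 4"
  proof -
    have "exp (real n) * (1 / sqrt (1 + 2 * (1 / (32 * n)) * (\<Sum>s<n. (y m s)\<^sup>2))) ^ k \<le> (1 / 72) ^ n"
      if "m \<in> S" for m
    proof -
      let ?t = "1 + 2 * (1 / (32 * n)) * (\<Sum>s<n. (y m s)\<^sup>2)"
      have "216 ^ 16 \<le> ?t" using that n by (simp add: S_def field_simps)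
      then have "sqrt ((216 ^ 8)\<^sup>2) \<le> sqrt ?t" by (intro real_sqrt_le_mono) simp
      then have "216 ^ 8 \<le> sqrt ?t" by simp
      then have "0 \<le> sqrt ?t" by (rule order_trans[rotated]) simp
      then have t0: "0 \<le> 1 / sqrt ?t" by (rule divide_nonneg_nonneg[OF zero_le_one])
      from \<open>216 ^ 8 \<le> sqrt ?t\<close> have "1 / sqrt ?t \<le> 1 / 216 ^ 8" by (intro frac_le) auto
      then have "1 / sqrt ?t \<le> (1 / 216) ^ 8" by (simp only: power_one_over)
      then have "(1 / sqrt ?t) ^ k \<le> ((1 / 216) ^ 8) ^ k"
        using t0 by (rule power_mono)
      also have "\<dots> \<le> (1 / 216) ^ n"
        unfolding power_mult[symmetric] by (rule power_decreasing) (use k in auto)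
      finally have "exp (real n) * (1 / sqrt ?t) ^ k \<le> 3 ^ n * (1 / 216) ^ n"
        using e3 t0 by (intro mult_mono zero_le_power) auto
      also have "\<dots> = (1 / 72) ^ n" by (simp add: power_mult_distrib[symmetric])
      finally show ?thesis .
    qed
    then have "(\<Sum>m\<in>S. exp (real n) * (1 / sqrt (1 + 2 * (1 / (32 * n)) * (\<Sum>s<n. (y m s)\<^sup>2))) ^ k)
        \<le> real (card S) * (1 / 72) ^ n"
      by (rule sum_bounded_above)
    also have "real (card S) \<le> real (card (int_ball {..<2*n} n))"
      unfolding of_nat_le_iff by (rule card_mono) (auto simp: S_def finite_int_ball)
    also have "\<dots> \<le> 2 ^ n * 3 ^ (2 * n)" using card_int_ball[of "{..<2*n}" n] by simp
    also have "2 ^ n * 3 ^ (2 * n) * (1 / 72 :: real) ^ n = (1 / 4) ^ n"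
      by (simp add: power_mult power_mult_distrib[symmetric])
    finally show ?thesis using quarter by simp
  qed
  have sumV: "(\<Sum>i<2*n. exp (- 4 * real n) * (1 / sqrt (1 + 2 * (- 1 / 4) * (\<Sum>s<n. (v i s)\<^sup>2))) ^ k) \<le> 1 / 4"
  proof -
    have e: "exp (- 4 * real n) \<le> (1 / 16) ^ n"
    proof -
      have "2 ^ 4 \<le> exp (1 :: real) ^ 4" by (rule power_mono) (use exp_ge_add_one_self[of 1] in auto)
      then have "16 \<le> exp (4 :: real)" by (simp add: exp_of_nat_mult[symmetric])
      then have "exp (- 4 :: real) \<le> 1 / 16" by (simp add: exp_minus field_simps)
      then have "exp (- 4 :: real) ^ n \<le> (1 / 16) ^ n" by (rule power_mono) simp
      then show ?thesis by (simp add: exp_of_nat_mult[symmetric] mult.commute)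
    qed
    have "exp (- 4 * real n) * (1 / sqrt (1 + 2 * (- 1 / 4) * (\<Sum>s<n. (v i s)\<^sup>2))) ^ k \<le> (1 / 8) ^ n"
      if "i \<in> {..<2*n}" for i
    proof -
      let ?t = "1 + 2 * (- 1 / 4) * (\<Sum>s<n. (v i s)\<^sup>2)"
      \<comment> \<open>As \<open>v i\<close> has length at most 1, \<open>?t\<close> is at least
        1/2 and hence at least 1/4; each of the \<open>k \<le> n\<close> rows thus costs a factor of
        at most 2.\<close>
      have "(1 / 2)\<^sup>2 \<le> ?t" using v[of i] that by (simp add: power2_eq_square)
      then have "1 / 2 \<le> sqrt ?t" by (rule real_le_rsqrt)
      then have "0 \<le> sqrt ?t" by (rule order_trans[rotated]) simp
      then have "0 \<le> 1 / sqrt ?t" by (rule divide_nonneg_nonneg[OF zero_le_one])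
      moreover have "1 / sqrt ?t \<le> 1 / (1 / 2)"
        using \<open>1 / 2 \<le> sqrt ?t\<close> by (intro frac_le) auto
      ultimately have t: "0 \<le> 1 / sqrt ?t" "1 / sqrt ?t \<le> 2" by simp_all
      have "(1 / sqrt ?t) ^ k \<le> 2 ^ k" using t by (intro power_mono)
      also have "\<dots> \<le> 2 ^ n" using k by simp
      finally have "exp (- 4 * real n) * (1 / sqrt ?t) ^ k \<le> (1 / 16) ^ n * 2 ^ n"
        using e t by (intro mult_mono) auto
      also have "\<dots> = (1 / 8) ^ n" by (simp add: power_mult_distrib[symmetric])
      finally show ?thesis .
    qed
    then have "(\<Sum>i<2*n. exp (- 4 * real n) * (1 / sqrt (1 + 2 * (- 1 / 4) * (\<Sum>s<n. (v i s)\<^sup>2))) ^ k)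
        \<le> real (card {..<2*n}) * (1 / 8) ^ n"
      by (rule sum_bounded_above)
    also have "\<dots> \<le> 2 ^ n * (1 / 8) ^ n"
    proof (rule mult_right_mono)
      have "2 * m \<le> 2 ^ m" if "m \<ge> 1" for m :: nat
        using that by (induction m rule: dec_induct) auto
      then show "real (card {..<2 * n}) \<le> 2 ^ n"
        using n of_nat_mono[of "2 * n" "2 ^ n", where 'a = real] by simp
    qed simp
    also have "\<dots> = (1 / 4) ^ n" by (simp add: power_mult_distrib[symmetric])
    finally show ?thesis using quarter by simp
  qed
  have split: "(\<Sum>a\<in>A. f a) = (\<Sum>m\<in>S. f (Inl m)) + (\<Sum>i<2*n. f (Inr i))" for f :: "(nat \<Rightarrow> int) + nat \<Rightarrow> real"
    unfolding A_def by (simp add: sum.Plus[OF finS] o_def)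
  have "(\<Sum>a\<in>A. al a * (1 / sqrt (1 + 2 * l a * (\<Sum>s<n. (u a s)\<^sup>2))) ^ k) \<le> 1 / 4 + 1 / 4"
    unfolding split using sumS sumV by (simp add: al_def l_def u_def)
  then have total: "(\<Sum>a\<in>A. al a * exp (- l a * (\<Sum>j<k. (\<Sum>s<n. u a s * g j s)\<^sup>2))) < 1"
    using g by linarith
  \<comment> \<open>All terms are nonnegative, so a total below 1 bounds every one of them; this
    plays the part of the union bound.\<close>
  have each: "al a * exp (- l a * (\<Sum>j<k. (\<Sum>s<n. u a s * g j s)\<^sup>2)) < 1" if "a \<in> A" for a
    using member_le_sum[OF that, of "\<lambda>a. al a * exp (- l a * (\<Sum>j<k. (\<Sum>s<n. u a s * g j s)\<^sup>2))"] fin total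
    by (force simp: al_def split: sum.splits)
  have gv: "(\<Sum>j<k. (\<Sum>s<n. v i s * g j s)\<^sup>2) < 16 * real n" if "i < 2 * n" for i
    using each[of "Inr i"] that by (auto simp: A_def al_def l_def u_def exp_add[symmetric])
  have gy: "(\<Sum>j<k. (\<Sum>s<n. y m s * g j s)\<^sup>2) > 32 * (real n)\<^sup>2" if "m \<in> S" for m
    using each[of "Inl m"] that n
    by (auto simp: A_def al_def l_def u_def exp_add[symmetric] field_simps power2_eq_square)
  show ?thesis
  proof (intro exI[of _ g] allI impI)
    fix a :: "nat \<Rightarrow> real"
    define x where "x s = (\<Sum>i<2*n. a i * v i s)" for s
    assume a: "(\<Sum>i<2*n. \<bar>a i\<bar>) \<le> 1"
    assume "\<forall>j<k. (\<Sum>s<n. (\<Sum>i<2*n. a i * v i s) * g j s) = 0"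
    then have ker: "(\<Sum>s<n. x s * g j s) = 0" if "j < k" for j
      using that by (simp add: x_def)
    \<comment> \<open>Each generator is stacked on its image under \<open>g\<close>, scaled by
      \<open>1 / (4 * sqrt n)\<close>. By \<open>gv\<close> both blocks have squared length at most
      1, hence the bound 2 in the approximation with \<open>n\<close> rounds.\<close>
    define q where "q = case_sum (\<lambda>s i. v i s) (\<lambda>j i. (\<Sum>s<n. v i s * g j s) / (4 * sqrt n))"
    let ?R = "{..<n} <+> {..<k}"
    have sR: "(\<Sum>r\<in>?R. f r) = (\<Sum>s<n. f (Inl s)) + (\<Sum>j<k. f (Inr j))" for f :: "nat + nat \<Rightarrow> real"
      by (simp add: sum.Plus o_def)
    have swap: "(\<Sum>i<2*n. c i * (\<Sum>s<n. v i s * g j s)) = (\<Sum>s<n. (\<Sum>i<2*n. c i * v i s) * g j s)" for c j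
      unfolding sum_distrib_left sum_distrib_right by (subst sum.swap) (simp add: mult_ac)
    have "(\<Sum>r\<in>?R. (q r i)\<^sup>2) \<le> 2" if "i \<in> {..<2*n}" for i
    proof -
      have "(\<Sum>j<k. (q (Inr j) i)\<^sup>2) = (\<Sum>j<k. (\<Sum>s<n. v i s * g j s)\<^sup>2) / (16 * real n)"
        unfolding sum_divide_distrib by (simp add: q_def power_divide power_mult_distrib)
      also have "\<dots> \<le> 1" using gv[of i] that n by (simp add: field_simps)
      finally show ?thesis unfolding sR using v[of i] that by (simp add: q_def)
    qed
    then obtain m where
      m: "(\<Sum>i<2*n. \<bar>m i\<bar>) \<le> int n" and
      d: "(\<Sum>r\<in>?R. (real n * (\<Sum>i<2*n. a i * q r i) - (\<Sum>i<2*n. real_of_int (m i) * q r i))\<^sup>2) \<le> real n * 2"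
      using maurey_approximation[of "{..<2*n}" a 2 q ?R n] a by auto
    define m' where "m' = restrict m {..<2*n}"
    have "\<bar>m i\<bar> \<le> int n" if "i < 2 * n" for i
      using member_le_sum[of i "{..<2*n}" "\<lambda>i. \<bar>m i\<bar>"] m that by auto
    then have m': "m' \<in> int_ball {..<2*n} n"
      using m by (force simp: m'_def int_ball_def abs_le_iff)
    have ym: "(\<Sum>i<2*n. real_of_int (m i) * v i s) = y m' s" for s
      by (simp add: y_def m'_def)
    \<comment> \<open>Since \<open>x\<close> lies in the kernel of \<open>g\<close>, the error in
      the second block is just the scaled image of the net point.\<close>
    have "(\<Sum>s<n. (real n * x s - y m' s)\<^sup>2) + (\<Sum>j<k. (\<Sum>s<n. y m' s * g j s)\<^sup>2) / (16 * real n) \<le> 2 * real n"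
    proof -
      have "(\<Sum>i<2*n. c i * q (Inr j) i) = (\<Sum>s<n. (\<Sum>i<2*n. c i * v i s) * g j s) / (4 * sqrt n)" for c j
        unfolding swap[symmetric] sum_divide_distrib by (simp add: q_def)
      then have "(\<Sum>j<k. (real n * (\<Sum>i<2*n. a i * q (Inr j) i) - (\<Sum>i<2*n. real_of_int (m i) * q (Inr j) i))\<^sup>2)
         = (\<Sum>j<k. (\<Sum>s<n. y m' s * g j s)\<^sup>2 / (16 * real n))"
        by (intro sum.cong refl) (simp add: ker x_def[symmetric] ym power_divide power_mult_distrib)
      moreover have "(\<Sum>s<n. (real n * (\<Sum>i<2*n. a i * q (Inl s) i) - (\<Sum>i<2*n. real_of_int (m i) * q (Inl s) i))\<^sup>2)
         = (\<Sum>s<n. (real n * x s - y m' s)\<^sup>2)"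
        by (simp add: q_def x_def ym)
      ultimately show ?thesis
        using d unfolding sR sum_divide_distrib by linarith
    qed
    moreover have "(\<Sum>j<k. (\<Sum>s<n. y m' s * g j s)\<^sup>2) / (16 * real n) \<ge> 0"
      by (simp add: sum_nonneg)
    moreover have "(\<Sum>s<n. (real n * x s - y m' s)\<^sup>2) \<ge> 0" by (simp add: sum_nonneg)
    ultimately have d1: "(\<Sum>s<n. (real n * x s - y m' s)\<^sup>2) \<le> 2 * real n"
      and d2: "(\<Sum>j<k. (\<Sum>s<n. y m' s * g j s)\<^sup>2) / (16 * real n) \<le> 2 * real n" by linarith+
    \<comment> \<open>The image of the net point is too short for a member of \<open>S\<close>, so
      the net point itself is short.\<close>
    have "(\<Sum>j<k. (\<Sum>s<n. y m' s * g j s)\<^sup>2) \<le> 32 * (real n)\<^sup>2"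
      using d2 n by (simp add: field_simps power2_eq_square)
    then have "m' \<notin> S" using gy[of m'] by linarith
    then have yl: "(\<Sum>s<n. (y m' s)\<^sup>2) \<le> 16 * 216 ^ 16 * real n" using m' by (simp add: S_def)
    have "(real n)\<^sup>2 * (\<Sum>s<n. (x s)\<^sup>2) = (\<Sum>s<n. (real n * x s)\<^sup>2)"
      by (simp add: sum_distrib_left power_mult_distrib)
    also have "\<dots> \<le> (\<Sum>s<n. 2 * (real n * x s - y m' s)\<^sup>2 + 2 * (y m' s)\<^sup>2)"
    proof (rule sum_mono)
      fix s
      have "0 \<le> (real n * x s - 2 * y m' s)\<^sup>2" by simp
      then show "(real n * x s)\<^sup>2 \<le> 2 * (real n * x s - y m' s)\<^sup>2 + 2 * (y m' s)\<^sup>2"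
        by (simp add: power2_eq_square algebra_simps)
    qed
    also have "\<dots> = 2 * (\<Sum>s<n. (real n * x s - y m' s)\<^sup>2) + 2 * (\<Sum>s<n. (y m' s)\<^sup>2)"
      by (simp add: sum.distrib sum_distrib_left)
    \<comment> \<open>Origin of the constant: the approximation error contributes
      \<open>2 * 2\<close>, the net point \<open>2 * 16 * 216 ^ 16\<close>.\<close>
    also have "\<dots> \<le> 2 * (2 * real n) + 2 * (16 * 216 ^ 16 * real n)"
      using d1 yl by (intro add_mono mult_left_mono) auto
    finally have "real n * (real n * (\<Sum>s<n. (x s)\<^sup>2)) \<le> real n * (4 + 32 * 216 ^ 16)"
      by (simp add: power2_eq_square algebra_simps)
    then have "real n * (\<Sum>s<n. (x s)\<^sup>2) \<le> 4 + 32 * 216 ^ 16"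
      by (rule mult_left_le_imp_le) (use n in simp)
    then show "real n * (\<Sum>s<n. (\<Sum>i<2*n. a i * v i s)\<^sup>2) \<le> 4 + 32 * 216 ^ 16"
      by (simp add: x_def)
  qed
qed

section \<open>Common kernels of functionals\<close>

text \<open>A basis of the kernel and one vector \<open>w\<close> of \<open>S\<close> outside it
  span \<open>S\<close>: subtracting \<open>(\<phi> x / \<phi> w) *\<^sub>R w\<close> moves
  \<open>x\<close> into the kernel. The finite set \<open>B\<close> keeps bases finite, as the
  ambient type may be infinite-dimensional.\<close>

lemma dim_le_Suc_dim_kernel:
  fixes \<phi> :: "'a::real_vector \<Rightarrow> real"
  assumes S: "subspace S" "S \<subseteq> span B" "finite B" and f: "linear \<phi>"
  shows "dim S \<le> Suc (dim {x \<in> S. \<phi> x = 0})"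
proof -
  let ?K = "{x \<in> S. \<phi> x = 0}"
  obtain C where C: "C \<subseteq> ?K" "independent C" "?K \<subseteq> span C" "card C = dim ?K"
    using basis_exists[of ?K] .
  have fC: "finite C" using independent_span_bound[OF S(3) C(2)] C(1) S(2) by auto
  show ?thesis
  proof (cases "S \<subseteq> ?K")
    case True
    then have "S = ?K" by auto
    then show ?thesis by simp
  next
    case False
    then obtain w where w: "w \<in> S" "\<phi> w \<noteq> 0" by auto
    have "S \<subseteq> span (insert w C)"
    proof
      fix x assume x: "x \<in> S"
      let ?t = "\<phi> x / \<phi> w"
      have "x - ?t *\<^sub>R w \<in> ?K"
        using x w S(1) f by (simp add: subspace_diff subspace_scale linear_diff linear_scale)
      then have "x - ?t *\<^sub>R w \<in> span C" using C(3) by blast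
      then show "x \<in> span (insert w C)" by (rule span_breakdown_eq[THEN iffD2, OF exI])
    qed
    then have "dim S \<le> card (insert w C)" by (rule dim_le_card) (use fC in simp)
    also have "\<dots> \<le> Suc (dim ?K)" using C(4) by (metis card_insert_if fC le_Suc_eq order_refl)
    finally show ?thesis .
  qed
qed

lemma subspace_kernels:
  fixes \<phi> :: "nat \<Rightarrow> 'a::real_vector \<Rightarrow> real"
  assumes "subspace S" "\<And>j. linear (\<phi> j)"
  shows "subspace {x \<in> S. \<forall>j<k. \<phi> j x = 0}"
  using assms by (auto simp: subspace_def linear_add linear_scale linear_0)

lemma dim_le_dim_kernels:
  fixes \<phi> :: "nat \<Rightarrow> 'a::real_vector \<Rightarrow> real"
  assumes S: "subspace S" "S \<subseteq> span B" "finite B" and f: "\<And>j. linear (\<phi> j)"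
  shows "dim S \<le> dim {x \<in> S. \<forall>j<k. \<phi> j x = 0} + k"
proof (induction k)
  case 0
  show ?case by simp
next
  case (Suc k)
  let ?K = "\<lambda>k. {x \<in> S. \<forall>j<k. \<phi> j x = 0}"
  have "dim (?K k) \<le> Suc (dim {x \<in> ?K k. \<phi> k x = 0})"
    by (rule dim_le_Suc_dim_kernel[OF subspace_kernels[OF S(1) f] _ S(3) f]) (use S(2) in auto)
  also have "{x \<in> ?K k. \<phi> k x = 0} = ?K (Suc k)" by (auto simp: less_Suc_eq)
  finally show ?case using Suc.IH by simp
qed

section \<open>Operators and norms on the coordinate spaces\<close>

definition unit_vec :: "nat \<Rightarrow> seq" where
  "unit_vec i = Poly_Mapping.single i 1"

lemma lookup_unit_vec: "Poly_Mapping.lookup (unit_vec i) j = (if i = j then 1 else 0)"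
  by (simp add: unit_vec_def lookup_single when_def)

lemma unit_vec_in_Rn: "i < n \<Longrightarrow> unit_vec i \<in> Rn n"
  by (auto simp: Rn_def lookup_unit_vec)

lemma l1_unit_vec: "i < n \<Longrightarrow> l1 n (unit_vec i) = 1"
  by (simp add: l1_def lookup_unit_vec)

lemma lookup_lincomb:
  "Poly_Mapping.lookup (\<Sum>i\<in>A. a i *\<^sub>R v i) s = (\<Sum>i\<in>A. a i * Poly_Mapping.lookup (v i) s)"
  by (simp add: lookup_sum lookup_scaleR)

lemma unit_vec_expansion:
  assumes "x \<in> Rn n"
  shows "x = (\<Sum>i<n. Poly_Mapping.lookup x i *\<^sub>R unit_vec i)"
proof (rule poly_mapping_eqI)
  fix s
  show "Poly_Mapping.lookup x s = Poly_Mapping.lookup (\<Sum>i<n. Poly_Mapping.lookup x i *\<^sub>R unit_vec i) s"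
    using assms by (auto simp: lookup_lincomb lookup_unit_vec Rn_def if_distrib[of "(*) _"] cong: if_cong)
qed

text \<open>Linearity is known on \<open>Rn n\<close> only, so the induction keeps the partial sums
  inside it. Both operators and the quotient map are expanded this way.\<close>

lemma linear_on_Rn_expansion:
  fixes T :: "seq \<Rightarrow> 'b::real_vector"
  assumes add: "\<And>x y. x \<in> Rn n \<Longrightarrow> y \<in> Rn n \<Longrightarrow> T (x + y) = T x + T y"
    and scale: "\<And>a x. x \<in> Rn n \<Longrightarrow> T (a *\<^sub>R x) = a *\<^sub>R T x"
    and x: "x \<in> Rn n"
  shows "T x = (\<Sum>i<n. Poly_Mapping.lookup x i *\<^sub>R T (unit_vec i))"
proof -
  have Z: "T 0 = 0" using scale[of 0 0] subspace_0[OF subspace_Rn] by simp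
  have "T (\<Sum>i\<in>A. a i *\<^sub>R unit_vec i) = (\<Sum>i\<in>A. a i *\<^sub>R T (unit_vec i))"
    if "finite A" "A \<subseteq> {..<n}" for A a
    using that
  proof (induction A)
    case empty
    then show ?case by (simp add: Z)
  next
    case (insert i A)
    have "(\<Sum>i\<in>A. a i *\<^sub>R unit_vec i) \<in> Rn n"
      using insert.prems by (intro subspace_sum subspace_scale subspace_Rn unit_vec_in_Rn) auto
    moreover have "unit_vec i \<in> Rn n" using insert.prems by (intro unit_vec_in_Rn) auto
    ultimately show ?case
      using insert by (simp add: add scale subspace_scale[OF subspace_Rn])
  qed
  from this[of "{..<n}" "Poly_Mapping.lookup x"] show ?thesis
    using unit_vec_expansion[OF x] by simp
qed

section \<open>Euclidean and l1 norms, boundedness of operators\<close>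

lemma l2_eq_L2_set: "l2 n x = L2_set (Poly_Mapping.lookup x) {..<n}"
  by (simp add: l2_def L2_set_def)

lemma l2_nonneg [simp]: "0 \<le> l2 n x"
  by (simp add: l2_def sum_nonneg)

lemma l2_0: "l2 n 0 = 0"
  by (simp add: l2_def)

lemma l2_scaleR: "l2 n (a *\<^sub>R x) = \<bar>a\<bar> * l2 n x"
  by (simp add: l2_def lookup_scaleR power_mult_distrib sum_distrib_left[symmetric] real_sqrt_mult)

lemma l2_le_l1: "l2 n x \<le> l1 n x"
  unfolding l2_eq_L2_set l1_def by (rule L2_set_le_sum_abs)

text \<open>Cauchy-Schwarz against the constant sequence 1.\<close>

lemma l1_le_sqrt_l2: "l1 n x \<le> sqrt n * l2 n x"
  using L2_set_mult_ineq[of "Poly_Mapping.lookup x" "\<lambda>_. 1" "{..<n}"]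
  by (simp add: l1_def l2_eq_L2_set L2_set_def mult.commute)

lemma abs_lookup_le_l2: "i < n \<Longrightarrow> \<bar>Poly_Mapping.lookup x i\<bar> \<le> l2 n x"
  unfolding l2_eq_L2_set using member_le_L2_set[of "{..<n}" i "\<lambda>i. \<bar>Poly_Mapping.lookup x i\<bar>"]
  by (simp add: L2_set_def)

lemma lin_op_0: "T \<in> lin_ops (Rn n) \<Longrightarrow> T 0 = 0"
  using subspace_0[OF subspace_Rn, of n] unfolding lin_ops_def
  by (metis (mono_tags, lifting) mem_Collect_eq scaleR_zero_left)

text \<open>Expansion in unit vectors gives a crude constant, which suffices to make the suprema in
  \<open>op_norm_on\<close> finite.\<close>

lemma lin_op_bounded:
  assumes T: "T \<in> lin_ops (Rn n)"
  obtains C where "C \<ge> 0" "\<And>x. x \<in> Rn n \<Longrightarrow> l1 n (T x) \<le> C * l2 n x"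
proof
  let ?C = "\<Sum>i<n. l1 n (T (unit_vec i))"
  show "?C \<ge> 0" by (intro sum_nonneg) (simp add: l1_def sum_nonneg)
  fix x assume x: "x \<in> Rn n"
  have "T x = (\<Sum>i<n. Poly_Mapping.lookup x i *\<^sub>R T (unit_vec i))"
    by (rule linear_on_Rn_expansion[OF _ _ x]) (use T in \<open>auto simp: lin_ops_def\<close>)
  then have "l1 n (T x) = (\<Sum>s<n. \<bar>\<Sum>i<n. Poly_Mapping.lookup x i * Poly_Mapping.lookup (T (unit_vec i)) s\<bar>)"
    by (simp add: l1_def lookup_lincomb)
  also have "\<dots> \<le> (\<Sum>s<n. \<Sum>i<n. \<bar>Poly_Mapping.lookup x i\<bar> * \<bar>Poly_Mapping.lookup (T (unit_vec i)) s\<bar>)"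
    by (intro sum_mono order_trans[OF sum_abs]) (simp add: abs_mult)
  also have "\<dots> = (\<Sum>i<n. \<bar>Poly_Mapping.lookup x i\<bar> * l1 n (T (unit_vec i)))"
    unfolding l1_def sum_distrib_left by (rule sum.swap)
  also have "\<dots> \<le> (\<Sum>i<n. l2 n x * l1 n (T (unit_vec i)))"
    by (intro sum_mono mult_right_mono abs_lookup_le_l2) (auto simp: l1_def sum_nonneg)
  finally show "l1 n (T x) \<le> ?C * l2 n x" by (simp add: sum_distrib_left mult.commute)
qed

text \<open>The generators are the images of the unit vectors under the quotient map. A
  representative that nearly attains the quotient norm supplies the coefficients; the gap
  \<open>e\<close> is there because the norm of a coset is an infimum.\<close>

lemma quotient_generators:
  assumes Q: "isometric_to_quotient (Rn n) N (Rn p) (l1 p)"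
  obtains v where "\<And>i. i < p \<Longrightarrow> v i \<in> Rn n" "\<And>i. i < p \<Longrightarrow> N (v i) \<le> 1"
    "\<And>x e. x \<in> Rn n \<Longrightarrow> e > 0 \<Longrightarrow> \<exists>a. x = (\<Sum>i<p. a i *\<^sub>R v i) \<and> (\<Sum>i<p. \<bar>a i\<bar>) < N x + e"
proof -
  obtain W \<Phi> where W: "subspace W" "W \<subseteq> Rn p"
    and bij: "bij_betw \<Phi> (Rn p // coset_rel (Rn p) W) (Rn n)"
    and add: "\<And>x y. x \<in> Rn p \<Longrightarrow> y \<in> Rn p \<Longrightarrow>
      \<Phi> (coset (Rn p) W (x + y)) = \<Phi> (coset (Rn p) W x) + \<Phi> (coset (Rn p) W y)"
    and scale: "\<And>a x. x \<in> Rn p \<Longrightarrow> \<Phi> (coset (Rn p) W (a *\<^sub>R x)) = a *\<^sub>R \<Phi> (coset (Rn p) W x)"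
    and iso: "\<And>C. C \<in> Rn p // coset_rel (Rn p) W \<Longrightarrow> N (\<Phi> C) = quot_norm (l1 p) C"
    using Q unfolding isometric_to_quotient_def by blast
  define q where "q x = \<Phi> (coset (Rn p) W x)" for x
  have cl: "coset (Rn p) W x \<in> Rn p // coset_rel (Rn p) W" if "x \<in> Rn p" for x
    using that by (rule quotientI)
  have mem: "x \<in> coset (Rn p) W x" if "x \<in> Rn p" for x
    using that subspace_0[OF W(1)] by (simp add: coset_rel_def)
  have bdd: "bdd_below (l1 p ` C)" for C
    by (rule bdd_belowI[of _ 0]) (auto simp: l1_def sum_nonneg)
  show thesis
  proof
    fix i assume i: "i < p"
    note e = unit_vec_in_Rn[OF i]
    show "q (unit_vec i) \<in> Rn n"
      using bij_betwE[OF bij] cl[OF e] by (simp add: q_def)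
    have "N (q (unit_vec i)) = quot_norm (l1 p) (coset (Rn p) W (unit_vec i))"
      unfolding q_def by (rule iso[OF cl[OF e]])
    also have "\<dots> \<le> l1 p (unit_vec i)"
      unfolding quot_norm_def by (rule cINF_lower[OF bdd mem[OF e]])
    finally show "N (q (unit_vec i)) \<le> 1" by (simp add: l1_unit_vec[OF i])
  next
    fix x :: seq and \<epsilon> :: real assume x: "x \<in> Rn n" and e: "\<epsilon> > 0"
    obtain C where C: "C \<in> Rn p // coset_rel (Rn p) W" "\<Phi> C = x"
      using bij x unfolding bij_betw_def by (metis imageE)
    obtain b where b: "b \<in> Rn p" "C = coset (Rn p) W b" using C(1) by (auto elim: quotientE)
    have "Inf (l1 p ` C) < N x + \<epsilon>" using iso[OF C(1)] C(2) e by (simp add: quot_norm_def)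
    then obtain a where a: "a \<in> C" "l1 p a < N x + \<epsilon>"
      using cInf_lessD[of "l1 p ` C"] mem[OF b(1)] b(2) by auto
    have aR: "a \<in> Rn p" and ba: "b - a \<in> W" using a(1) b by (auto simp: coset_rel_def)
    have "coset (Rn p) W a = C"
    proof -
      have "a - y \<in> W \<longleftrightarrow> b - y \<in> W" for y
        using subspace_diff[OF W(1) _ ba, of "b - y"] subspace_add[OF W(1) ba, of "a - y"] by auto
      then show ?thesis using aR b by (auto simp: coset_rel_def)
    qed
    then have "x = q a" using C(2) by (simp add: q_def)
    also have "\<dots> = (\<Sum>i<p. Poly_Mapping.lookup a i *\<^sub>R q (unit_vec i))"
      by (rule linear_on_Rn_expansion[OF _ _ aR]) (auto simp: q_def add scale)
    finally show "\<exists>a. x = (\<Sum>i<p. a i *\<^sub>R q (unit_vec i)) \<and> (\<Sum>i<p. \<bar>a i\<bar>) < N x + \<epsilon>"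
      using a(2) unfolding l1_def by blast
  qed
qed

section \<open>A Kashin-type theorem for quotients of l1\<close>

definition kashin_const :: real where
  "kashin_const = sqrt (4 + 32 * 216 ^ 16)"

lemma kashin_const_ge_2: "kashin_const \<ge> 2"
  unfolding kashin_const_def by (rule real_le_rsqrt) simp

text \<open>The rows from \<open>kashin_rows\<close> for the generators serve as functionals. The
  limit \<open>8 * k \<le> 3 * n\<close> is what a subspace of dimension above \<open>7n/8\<close>
  can lose while keeping more than \<open>n/2\<close>.\<close>

lemma quotient_of_l1_kashin:
  assumes n: "n \<ge> 2" and Q: "isometric_to_quotient (Rn n) N (Rn (2 * n)) (l1 (2 * n))"
    and l2N: "\<And>x. x \<in> Rn n \<Longrightarrow> l2 n x \<le> N x"
  obtains k and \<phi> :: "nat \<Rightarrow> seq \<Rightarrow> real" where "8 * k \<le> 3 * n" "\<And>j. linear (\<phi> j)"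
    "\<And>x. x \<in> Rn n \<Longrightarrow> (\<And>j. j < k \<Longrightarrow> \<phi> j x = 0) \<Longrightarrow> sqrt n * l2 n x \<le> kashin_const * N x"
proof (cases "n \<le> 3")
  case True
  show thesis
  \<comment> \<open>For \<open>n \<le> 3\<close> nothing is cut out:
    \<open>sqrt n \<le> 2 \<le> kashin_const\<close> already suffices.\<close>
  proof (rule that[of 0 "\<lambda>_ _. 0"])
    fix x assume x: "x \<in> Rn n"
    have "sqrt n \<le> sqrt (2\<^sup>2)" using True by (intro real_sqrt_le_mono) simp
    then have "sqrt n \<le> kashin_const" using kashin_const_ge_2 by simp
    then show "sqrt n * l2 n x \<le> kashin_const * N x"
      using l2N[OF x] kashin_const_ge_2 by (intro mult_mono) auto
  qed (auto intro: linear_zero)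
next
  case False
  obtain v where v: "\<And>i. i < 2 * n \<Longrightarrow> v i \<in> Rn n" "\<And>i. i < 2 * n \<Longrightarrow> N (v i) \<le> 1"
    "\<And>x e. x \<in> Rn n \<Longrightarrow> e > 0 \<Longrightarrow> \<exists>a. x = (\<Sum>i<2*n. a i *\<^sub>R v i) \<and> (\<Sum>i<2*n. \<bar>a i\<bar>) < N x + e"
    using quotient_generators[OF Q] by blast
  \<comment> \<open>This is \<open>n / 8\<close> rounded up, so \<open>n \<le> 8 * k\<close>; from
    \<open>n = 4\<close> on, \<open>8 * k \<le> n + 7 \<le> 3 * n\<close>.\<close>
  define k where "k = (n + 7) div 8"
  have k: "n \<le> 8 * k" "k \<le> n" "8 * k \<le> 3 * n" using False by (auto simp: k_def)
  define w where "w i = Poly_Mapping.lookup (v i)" for i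
  have w: "(\<Sum>s<n. (w i s)\<^sup>2) \<le> 1" if "i < 2 * n" for i
    using order_trans[OF l2N[OF v(1)[OF that]] v(2)[OF that]] by (simp add: l2_def w_def)
  have n1: "1 \<le> n" using n by simp
  obtain g :: "nat \<Rightarrow> nat \<Rightarrow> real" where g: "(\<Sum>i<2*n. \<bar>a i\<bar>) \<le> 1 \<longrightarrow>
      (\<forall>j<k. (\<Sum>s<n. (\<Sum>i<2*n. a i * w i s) * g j s) = 0) \<longrightarrow>
      real n * (\<Sum>s<n. (\<Sum>i<2*n. a i * w i s)\<^sup>2) \<le> 4 + 32 * 216 ^ 16" for a
    using kashin_rows[of n k w, OF n1 k(1,2) w] by blast
  define \<phi> where "\<phi> j x = (\<Sum>s<n. Poly_Mapping.lookup x s * g j s)" for j x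
  show thesis
  proof (rule that[OF k(3)])
    show "linear (\<phi> j)" for j
      by (rule linearI)
        (auto simp: \<phi>_def lookup_add lookup_scaleR distrib_right sum.distrib sum_distrib_left mult.assoc)
    fix x assume x: "x \<in> Rn n" and ker: "\<And>j. j < k \<Longrightarrow> \<phi> j x = 0"
    have N0: "N x \<ge> 0" using l2N[OF x] l2_nonneg[of n x] by linarith
    \<comment> \<open>Dividing the coefficients by \<open>N x + e\<close>, positive even when
      \<open>N x = 0\<close>, puts them into the l1 unit ball; \<open>e\<close> tends to 0
      afterwards.\<close>
    have eps: "sqrt n * l2 n x \<le> kashin_const * (N x + e)" if e: "e > 0" for e
    proof -
      define t where "t = N x + e"
      have t: "t > 0" using N0 e by (simp add: t_def)
      obtain a where a: "x = (\<Sum>i<2*n. a i *\<^sub>R v i)" "(\<Sum>i<2*n. \<bar>a i\<bar>) < t"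
        using v(3)[OF x e] by (auto simp: t_def)
      have xs: "(\<Sum>i<2*n. a i / t * w i s) = Poly_Mapping.lookup x s / t" for s
        unfolding a(1) lookup_lincomb by (simp add: w_def sum_divide_distrib)
      have "real n * (\<Sum>s<n. (\<Sum>i<2*n. a i / t * w i s)\<^sup>2) \<le> 4 + 32 * 216 ^ 16"
      proof (rule g[rule_format])
        show "(\<Sum>i<2*n. \<bar>a i / t\<bar>) \<le> 1"
          using a(2) t by (simp add: sum_divide_distrib[symmetric])
        show "(\<Sum>s<n. (\<Sum>i<2*n. a i / t * w i s) * g j s) = 0" if "j < k" for j
          using ker[OF that] unfolding xs by (simp add: \<phi>_def sum_divide_distrib[symmetric])
      qed
      then have "real n * (\<Sum>s<n. (Poly_Mapping.lookup x s)\<^sup>2) \<le> (4 + 32 * 216 ^ 16) * t\<^sup>2"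
        unfolding xs using t by (simp add: power_divide sum_divide_distrib[symmetric] pos_divide_le_eq)
      then have "sqrt (real n * (\<Sum>s<n. (Poly_Mapping.lookup x s)\<^sup>2)) \<le> sqrt ((4 + 32 * 216 ^ 16) * t\<^sup>2)"
        by (rule real_sqrt_le_mono)
      then show ?thesis
        using t by (simp add: real_sqrt_mult l2_def kashin_const_def t_def)
    qed
    show "sqrt n * l2 n x \<le> kashin_const * N x"
    proof (rule field_le_epsilon)
      fix e :: real assume "e > 0"
      then show "sqrt n * l2 n x \<le> kashin_const * N x + e"
        using eps[of "e / kashin_const"] kashin_const_ge_2 by (simp add: distrib_left)
    qed
  qed
qed

text \<open>Comparing \<open>N\<close> with \<open>l2\<close> and \<open>M\<close> with
  \<open>l1\<close> bounds the set under the supremum. The form with two functionals covers the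
  Euclidean norm on \<open>E\<close> and the norm of the space alike.\<close>

lemma op_norm_on_bounds:
  assumes T: "T \<in> lin_ops (Rn n)" and Z: "subspace Z" "Z \<subseteq> Rn n"
    and N: "\<And>x. x \<in> Rn n \<Longrightarrow> l2 n x \<le> N x" "N 0 = 0"
    and M: "\<And>x. x \<in> Rn n \<Longrightarrow> M x \<le> l1 n x" "M 0 = 0"
  shows op_norm_on_upper: "\<And>x. x \<in> Z \<Longrightarrow> N x \<le> 1 \<Longrightarrow> M (T x) \<le> op_norm_on Z N M T"
    and op_norm_on_nonneg: "0 \<le> op_norm_on Z N M T"
proof -
  obtain C where C: "C \<ge> 0" "\<And>x. x \<in> Rn n \<Longrightarrow> l1 n (T x) \<le> C * l2 n x"
    using lin_op_bounded[OF T] by blast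
  have "M (T x) \<le> C" if "x \<in> Z" "N x \<le> 1" for x
  proof -
    have x: "x \<in> Rn n" "T x \<in> Rn n" using that Z T by (auto simp: lin_ops_def)
    have "M (T x) \<le> C * l2 n x" using M(1)[OF x(2)] C(2)[OF x(1)] by linarith
    also have "\<dots> \<le> C * 1" using N(1)[OF x(1)] that C(1) by (intro mult_left_mono) auto
    finally show ?thesis by simp
  qed
  then have bdd: "bdd_above ((\<lambda>x. M (T x)) ` {x \<in> Z. N x \<le> 1})"
    by (intro bdd_aboveI[of _ C]) auto
  show upper: "M (T x) \<le> op_norm_on Z N M T" if "x \<in> Z" "N x \<le> 1" for x
    unfolding op_norm_on_def by (rule cSUP_upper[OF _ bdd]) (use that in simp)
  show "0 \<le> op_norm_on Z N M T"
    using upper[of 0] subspace_0[OF Z(1)] N(2) M(2) lin_op_0[OF T] by simp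
qed

text \<open>Homogeneity; vectors with \<open>l2 n x = 0\<close> cannot be normalised and are handled
  by \<open>lin_op_bounded\<close>.\<close>

lemma l2_le_op_norm_on:
  assumes V: "V \<in> lin_ops (Rn n)" and E: "subspace E" "E \<subseteq> Rn n" and x: "x \<in> E"
  shows "l2 n (V x) \<le> op_norm_on E (l2 n) (l2 n) V * l2 n x"
proof (cases "l2 n x = 0")
  case True
  obtain C where "l1 n (V x) \<le> C * l2 n x" using lin_op_bounded[OF V] x E(2) by blast
  then show ?thesis using True l2_le_l1[of n "V x"] by simp
next
  case False
  let ?r = "inverse (l2 n x)"
  have r: "l2 n x > 0" using False l2_nonneg[of n x] by linarith
  have "l2 n (?r *\<^sub>R x) \<le> 1" using r by (simp add: l2_scaleR)
  then have "l2 n (V (?r *\<^sub>R x)) \<le> op_norm_on E (l2 n) (l2 n) V"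
    using subspace_scale[OF E(1) x]
    by (intro op_norm_on_upper[OF V E]) (auto simp: l2_le_l1 l2_0)
  moreover have "V (?r *\<^sub>R x) = ?r *\<^sub>R V x" using V E x by (auto simp: lin_ops_def)
  ultimately show ?thesis using r by (simp add: l2_scaleR field_simps)
qed

section \<open>Choice of the scalar and of the subspace for the Gelfand number\<close>

theorem theorem2p2:
  fixes c :: real
  assumes "c > 0"
    and "\<forall>n\<ge>2. \<exists>N. few_ops_space c n N"
  shows "\<exists>K>0. \<forall>n\<ge>2. \<forall>N. few_ops_space c n N \<longrightarrow>
    (\<forall>T \<in> lin_ops (Rn n).
       (INF l::real. gelfand_number (real n / 2) (Rn n) N N (\<lambda>x. T x - l *\<^sub>R x))
         \<le> K * real n powr (-1/2) * op_norm_on (Rn n) N N T)"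
proof (intro exI[of _ "kashin_const * c"] conjI allI impI ballI)
  show "kashin_const * c > 0" using kashin_const_ge_2 assms(1) by simp
  fix n :: nat and N and T :: "seq \<Rightarrow> seq"
  assume n: "2 \<le> n" and X: "few_ops_space c n N" and T: "T \<in> lin_ops (Rn n)"
  let ?R = "Rn n"
  have Q: "isometric_to_quotient ?R N (Rn (2 * n)) (l1 (2 * n))"
    and l2N: "\<And>x. x \<in> ?R \<Longrightarrow> l2 n x \<le> N x" and Nl1: "\<And>x. x \<in> ?R \<Longrightarrow> N x \<le> l1 n x"
    and N0: "N 0 = 0"
    using X subspace_0[OF subspace_Rn, of n] by (auto simp: few_ops_space_def norm_on_def)
  obtain l V E where V: "V \<in> lin_ops ?R" and E: "subspace E" "E \<subseteq> ?R" "real (dim E) > 7 * real n / 8"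
    and VT: "\<And>x. x \<in> ?R \<Longrightarrow> V x = T x + l *\<^sub>R x"
    and VE: "op_norm_on E (l2 n) (l2 n) V \<le> c * real n powr (-1/2) * op_norm_on ?R N N T"
    using X T unfolding few_ops_space_def by blast
  obtain k and \<phi> :: "nat \<Rightarrow> seq \<Rightarrow> real" where k: "8 * k \<le> 3 * n" and lin: "\<And>j. linear (\<phi> j)"
    and ker: "\<And>x. x \<in> ?R \<Longrightarrow> (\<And>j. j < k \<Longrightarrow> \<phi> j x = 0) \<Longrightarrow> sqrt n * l2 n x \<le> kashin_const * N x"
    using quotient_of_l1_kashin[OF n Q l2N] by blast
  define Z where "Z = {x \<in> E. \<forall>j<k. \<phi> j x = 0}"
  have Z: "subspace Z" "Z \<subseteq> E" "Z \<subseteq> ?R"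
    using subspace_kernels[OF E(1) lin] E(2) by (auto simp: Z_def)
  obtain B where B: "?R \<subseteq> span B" "card B = n" using basis_exists[of ?R] dim_Rn by metis
  have fB: "finite B" using B(2) n by (intro card_ge_0_finite) simp
  have "dim E \<le> dim Z + k"
    unfolding Z_def by (rule dim_le_dim_kernels[OF E(1) order_trans[OF E(2) B(1)] fB lin])
  \<comment> \<open>The dimension of \<open>E\<close> exceeds \<open>7n/8\<close> and at most
    \<open>3n/8\<close> is lost to the kernels, which gives the strict bound.\<close>
  then have codim: "real (dim ?R) - real (dim Z) < real n / 2"
    using E(3) k unfolding dim_Rn by linarith
  define opE where "opE = op_norm_on E (l2 n) (l2 n) V"
  have opE0: "opE \<ge> 0"
    unfolding opE_def using op_norm_on_nonneg[OF V E(1,2), of "l2 n" "l2 n"] by (simp add: l2_le_l1 l2_0)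
  \<comment> \<open>The scalar is \<open>- l\<close>, for which
    \<open>T x - (- l) *\<^sub>R x\<close> is \<open>V x\<close>. The factor \<open>sqrt n\<close>
    from comparing \<open>l1\<close> with \<open>l2\<close> is absorbed by
    \<open>ker\<close>.\<close>
  have VZ: "op_norm_on Z N N (\<lambda>x. T x - (- l) *\<^sub>R x) \<le> kashin_const * opE"
    unfolding op_norm_on_def
  proof (rule cSUP_least)
    show "{x \<in> Z. N x \<le> 1} \<noteq> {}" using subspace_0[OF Z(1)] N0 by auto
    fix x assume "x \<in> {x \<in> Z. N x \<le> 1}"
    then have x: "x \<in> Z" "N x \<le> 1" "x \<in> E" "x \<in> ?R" using Z by auto
    have "N (V x) \<le> l1 n (V x)" using Nl1 V x(4) by (auto simp: lin_ops_def)
    also have "\<dots> \<le> sqrt n * l2 n (V x)" by (rule l1_le_sqrt_l2)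
    also have "\<dots> \<le> sqrt n * (opE * l2 n x)"
      unfolding opE_def by (intro mult_left_mono l2_le_op_norm_on[OF V E(1,2) x(3)]) auto
    also have "\<dots> = opE * (sqrt n * l2 n x)" by simp
    also have "\<dots> \<le> opE * (kashin_const * 1)"
    proof (rule mult_left_mono[OF _ opE0])
      have "sqrt n * l2 n x \<le> kashin_const * N x" using ker[OF x(4)] x(1) by (simp add: Z_def)
      also have "\<dots> \<le> kashin_const * 1" using x(2) kashin_const_ge_2 by (intro mult_left_mono) auto
      finally show "sqrt n * l2 n x \<le> kashin_const * 1" .
    qed
    finally show "N (T x - (- l) *\<^sub>R x) \<le> kashin_const * opE" using VT[OF x(4)] by (simp add: mult.commute)
  qed
  have T': "(\<lambda>x. T x - a *\<^sub>R x) \<in> lin_ops ?R" for a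
    using T subspace_Rn[of n]
    by (auto simp: lin_ops_def algebra_simps intro!: subspace_diff subspace_scale)
  \<comment> \<open>Nonnegativity bounds both infima from below, over subspaces and over scalars, so
    that a single choice in each bounds them from above.\<close>
  have nonneg: "0 \<le> op_norm_on Y N N (\<lambda>x. T x - a *\<^sub>R x)" if "subspace Y" "Y \<subseteq> ?R" for Y a
    by (rule op_norm_on_nonneg[OF T' that l2N N0 Nl1 N0])
  have bddZ: "bdd_below ((\<lambda>Z. op_norm_on Z N N (\<lambda>x. T x - a *\<^sub>R x)) `
      {Z. subspace Z \<and> Z \<subseteq> ?R \<and> real (dim ?R) - real (dim Z) < real n / 2})" for a
    by (rule bdd_belowI[of _ 0]) (auto simp: nonneg)
  \<comment> \<open>The whole space, of codimension 0, shows that the family of subspaces is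
    nonempty.\<close>
  have g0: "0 \<le> gelfand_number (real n / 2) ?R N N (\<lambda>x. T x - a *\<^sub>R x)" for a
    unfolding gelfand_number_def
    by (rule cINF_greatest) (use subspace_Rn[of n] n nonneg in auto)
  have "(INF l::real. gelfand_number (real n / 2) ?R N N (\<lambda>x. T x - l *\<^sub>R x))
      \<le> gelfand_number (real n / 2) ?R N N (\<lambda>x. T x - (- l) *\<^sub>R x)"
    by (rule cINF_lower) (auto intro!: bdd_belowI[of _ 0] g0)
  also have "\<dots> \<le> op_norm_on Z N N (\<lambda>x. T x - (- l) *\<^sub>R x)"
    unfolding gelfand_number_def by (rule cINF_lower[OF bddZ]) (use Z codim in auto)
  also note VZ
  also have "kashin_const * opE \<le> kashin_const * (c * real n powr (-1/2) * op_norm_on ?R N N T)"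
    using VE kashin_const_ge_2 unfolding opE_def by (intro mult_left_mono) auto
  finally show "(INF l::real. gelfand_number (real n / 2) ?R N N (\<lambda>x. T x - l *\<^sub>R x))
      \<le> kashin_const * c * real n powr (-1/2) * op_norm_on ?R N N T" by (simp only: mult.assoc)
qed

end
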